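(* Let $n$ and $k$ be integers with $0\le k\le n$. Then $$\sum_{i\ge 0}\binom{n-2i}{k-i}=\sum_{j\ge 0}(-1)^j\binom{n+1-j}{k+1+j}+\varepsilon(n-2k),$$ that is, $$\binom{n}{k}+\binom{n-2}{k-1}+\binom{n-4}{k-2}+\ldots=\binom{n+1}{k+1}-\binom{n}{k+2}+\binom{n-1}{k+3}-\ldots+\varepsilon(n-2k),$$ where for an integer $m$ the correction term $\varepsilon(m)$ is defined by $$\varepsilon(m)=\begin{cases}0, & m\le 0,\\ 0, & m>0 \text{ and } m=6p \text{ or } m=6p+3 \text{ for some integer } p,\\ -1, & m>0 \text{ and } m=6p+1 \text{ or } m=6p+2 \text{ for some integer } p,\\ 1, & m>0 \text{ and } m=6p-1 \text{ or } m=6p-2 \text{ for some integer } p.\end{cases}$$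
   Context: Here $\binom{a}{b}$ denotes the entry of the Pascal triangle in row $a$ and position $b$: for integers $a,b$ it is the usual binomial coefficient $\frac{a!}{b!(a-b)!}$ if $0\le b\le a$, and it is $0$ otherwise (in particular it is $0$ whenever $a<0$ or $b<0$ or $b>a$). With this convention both sums have only finitely many nonzero terms: they run over the entries that lie inside the Pascal triangle. *)

theory Defs
  imports Main "HOL-Library.Groups_Big_Fun"
begin

definition pascal :: "int \<Rightarrow> int \<Rightarrow> int" where
  "pascal a b = (if 0 \<le> b \<and> b \<le> a then int (nat a choose nat b) else 0)"

definition eps :: "int \<Rightarrow> int" where
  "eps m =
    (if m \<le> 0 then 0
     else if \<exists>p. m = 6 * p \<or> m = 6 * p + 3 then 0
     else if \<exists>p. m = 6 * p + 1 \<or> m = 6 * p + 2 then - 1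
     else 1)"

lemma eps_cases_exhaustive:
  fixes m :: int
  shows "(\<exists>p. m = 6 * p \<or> m = 6 * p + 3) \<or> (\<exists>p. m = 6 * p + 1 \<or> m = 6 * p + 2)
    \<or> (\<exists>p. m = 6 * p - 1 \<or> m = 6 * p - 2)"
  by presburger

lemma eps_eq_1:
  assumes "m > 0" "m = 6 * p - 1 \<or> m = 6 * p - 2"
  shows "eps m = 1"
proof -
  have "\<not> (\<exists>q. m = 6 * q \<or> m = 6 * q + 3)" "\<not> (\<exists>q. m = 6 * q + 1 \<or> m = 6 * q + 2)"
    using assms(2) by presburger+
  then show ?thesis using assms(1) by (simp add: eps_def)
qed

(* Sum_any is the sum over the support, with value 0 if the support is infinite.
   The next two facts exclude that default case. *)

lemma finite_support_left:
  fixes n k :: int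
  shows "finite {i :: nat. pascal (n - 2 * int i) (k - int i) \<noteq> 0}"
proof (rule finite_subset)
  show "{i :: nat. pascal (n - 2 * int i) (k - int i) \<noteq> 0} \<subseteq> {..nat k}"
    by (auto simp: pascal_def split: if_splits)
qed simp

lemma finite_support_right:
  fixes n k :: int
  shows "finite {j :: nat. (- 1) ^ j * pascal (n + 1 - int j) (k + 1 + int j) \<noteq> 0}"
proof (rule finite_subset)
  show "{j :: nat. (- 1) ^ j * pascal (n + 1 - int j) (k + 1 + int j) \<noteq> 0} \<subseteq> {..nat (n - k)}"
    by (auto simp: pascal_def split: if_splits)
qed simp

end

(* Both sides satisfy F(n, k) = C(n, k) + F(n - 2, k - 1), and the correction term is unchanged under
   (n, k) -> (n - 2, k - 1); this reduces the identity to the two edges k = n, where both sides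
   are 1, and k = 0. On the edge k = 0 the correction 1 - (right-hand sum) satisfies
   u(n) = u(n - 1) - u(n - 2), whose solutions have period 6. *)
theory Submission imports Defs begin

text \<open>Finiteness is essential: \<open>Sum_any\<close> is 0 on infinite support, so peeling off
  a nonzero \<open>f 0\<close> would then change the value.\<close>

lemma Sum_any_nat_shift:
  fixes f :: "nat \<Rightarrow> 'a::comm_monoid_add"
  assumes "finite {i. f i \<noteq> 0}"
  shows "Sum_any f = f 0 + (\<Sum>i. f (Suc i))"
proof -
  obtain N where N: "{i. f i \<noteq> 0} \<subseteq> {..N}"
    using assms unfolding finite_nat_set_iff_bounded_le by blast
  have "Sum_any f = sum f {..Suc N}"
    by (rule Sum_any.expand_superset) (use N in auto)
  also have "\<dots> = f 0 + (\<Sum>i\<le>N. f (Suc i))"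
    by (rule sum.atMost_Suc_shift)
  also have "(\<Sum>i\<le>N. f (Suc i)) = (\<Sum>i. f (Suc i))"
    by (rule Sum_any.expand_superset [symmetric]) (use N in auto)
  finally show ?thesis .
qed

text \<open>With entries outside the triangle set to 0, Pascal's rule fails only at the apex (0, 0),
  where it would read 1 = 0 + 0.\<close>

lemma pascal_rec:
  assumes "a \<noteq> 0 \<or> b \<noteq> 0"
  shows "pascal a b = pascal (a - 1) b + pascal (a - 1) (b - 1)"
proof (cases "0 \<le> b \<and> b \<le> a")
  case True
  then have "0 < a" using assms by linarith
  then obtain m where m: "a = int (Suc m)"
    by (metis gr0_conv_Suc pos_int_cases)
  show ?thesis
  proof (cases "b = 0")
    case True
    then show ?thesis using m by (simp add: pascal_def)
  next
    case False
    then have "0 < b" using True by linarith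
    then obtain l where l: "b = int (Suc l)"
      by (metis gr0_conv_Suc pos_int_cases)
    then show ?thesis using True m by (auto simp: pascal_def nat_add_distrib)
  qed
qed (auto simp: pascal_def)

text \<open>Row plus position is constantly n + k along these terms. The right-hand sum of the
  theorem is \<open>alt_diag (n + 1) (k + 1)\<close>.\<close>

definition alt_diag :: "int \<Rightarrow> int \<Rightarrow> int" where
  "alt_diag n k = (\<Sum>j::nat. (- 1) ^ j * pascal (n - int j) (k + int j))"

lemma finite_support_alt_diag:
  "finite {j :: nat. (- 1) ^ j * pascal (n - int j) (k + int j) \<noteq> 0}"
  using finite_support_right [of "n - 1" "k - 1"] by simp

lemma alt_diag_shift: "alt_diag n k = pascal n k - alt_diag (n - 1) (k + 1)"
proof -
  have "alt_diag n k = pascal n k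
      + (\<Sum>j::nat. (- 1) * ((- 1) ^ j * pascal (n - 1 - int j) (k + 1 + int j)))"
    unfolding alt_diag_def
    by (subst Sum_any_nat_shift [OF finite_support_alt_diag]) (simp add: algebra_simps)
  then show ?thesis
    unfolding alt_diag_def
    using Sum_any_right_distrib [OF finite_support_alt_diag [of "n - 1" "k + 1"], of "- 1"]
    by simp
qed

text \<open>Pascal's rule is applied term by term; since row plus position equals n + k \<noteq> 0
  in every term, the apex is never met.\<close>

lemma alt_diag_rec:
  assumes "n + k \<noteq> 0"
  shows "alt_diag n k = alt_diag (n - 1) k + alt_diag (n - 1) (k - 1)"
proof -
  have "pascal (n - int j) (k + int j)
      = pascal (n - 1 - int j) (k + int j) + pascal (n - 1 - int j) (k - 1 + int j)" for j
    using pascal_rec [of "n - int j" "k + int j"] assms by (simp add: algebra_simps)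
  then show ?thesis
    unfolding alt_diag_def
    by (simp only: distrib_left Sum_any.distrib [OF finite_support_alt_diag finite_support_alt_diag])
qed

text \<open>Expanding by Pascal's rule and then shifting one summand gives
  \<open>alt_diag (n - 1) (k + 1)\<close> with both signs, and it cancels.\<close>

lemma alt_diag_two_step:
  assumes "0 < n + k"
  shows "alt_diag (n + 1) (k + 1) = pascal n k + alt_diag (n - 1) k"
  using alt_diag_rec [of "n + 1" "k + 1"] alt_diag_shift [of n k]
    alt_diag_rec [of n "k + 1"] assms
  by simp

lemma alt_diag_eq_0:
  assumes "n < k"
  shows "alt_diag n k = 0"
proof -
  have "pascal (n - int j) (k + int j) = 0" for j
    using assms by (simp add: pascal_def)
  then show ?thesis by (simp add: alt_diag_def)
qed

lemma alt_diag_diagonal: "0 \<le> n \<Longrightarrow> alt_diag n n = 1"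
  using alt_diag_shift [of n n] by (simp add: alt_diag_eq_0 pascal_def)

lemma eps_mod_6:
  "eps m = (if m \<le> 0 \<or> m mod 6 \<in> {0, 3} then 0 else if m mod 6 \<in> {1, 2} then - 1 else 1)"
proof -
  have "(\<exists>p. m = 6 * p \<or> m = 6 * p + 3) \<longleftrightarrow> m mod 6 \<in> {0, 3}"
    "(\<exists>p. m = 6 * p + 1 \<or> m = 6 * p + 2) \<longleftrightarrow> m mod 6 \<in> {1, 2}"
    unfolding insert_iff empty_iff by presburger+
  then show ?thesis by (simp add: eps_def)
qed

lemma eps_rec:
  assumes "0 \<le> m"
  shows "eps (m + 2) = eps (m + 1) - eps m"
proof -
  define r where "r = m mod 6"
  have r: "(m + 1) mod 6 = (r + 1) mod 6" "(m + 2) mod 6 = (r + 2) mod 6"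
    by (simp_all add: r_def mod_add_left_eq)
  have eps: "eps (m + 2) = (if (r + 2) mod 6 \<in> {0, 3} then 0 else if (r + 2) mod 6 \<in> {1, 2} then - 1 else 1)"
    "eps (m + 1) = (if (r + 1) mod 6 \<in> {0, 3} then 0 else if (r + 1) mod 6 \<in> {1, 2} then - 1 else 1)"
    "eps m = (if r \<in> {0, 3} then 0 else if r \<in> {1, 2} then - 1 else 1)"
    using assms by (auto simp only: eps_mod_6 r r_def [symmetric]) (auto simp: r_def)
  have "r = 0 \<or> r = 1 \<or> r = 2 \<or> r = 3 \<or> r = 4 \<or> r = 5"
    unfolding r_def by presburger
  then show ?thesis
    unfolding eps by (elim disjE) simp_all
qed

lemma alt_diag_1: "alt_diag (int n + 1) 1 = 1 - eps (int n)"
proof (induction n rule: less_induct)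
  case (less n)
  consider "n = 0" | "n = 1" | m where "n = m + 2"
    by (metis One_nat_def add_2_eq_Suc' not0_implies_Suc)
  then show ?case
  proof cases
    case 1
    then show ?thesis using alt_diag_diagonal [of 1] by (simp add: eps_def)
  next
    case 2
    have "eps 1 = - 1" by (simp add: eps_def) presburger
    moreover have "alt_diag 2 1 = 2"
      using alt_diag_shift [of 2 1] by (simp add: alt_diag_eq_0 pascal_def)
    ultimately show ?thesis using 2 by simp
  next
    case (3 m)
    \<comment> \<open>Pascal's rule leads to position 0, and the shift returns to position 1; the
      constant 1 is the border entry \<open>pascal (int m + 2) 0\<close>. Subtracting from 1 gives
      the recurrence of \<open>eps_rec\<close>.\<close>
    have "alt_diag (int m + 3) 1 = alt_diag (int m + 2) 1 + (1 - alt_diag (int m + 1) 1)"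
      using alt_diag_rec [of "int m + 3" 1] alt_diag_shift [of "int m + 2" 0]
      by (simp add: pascal_def add.commute)
    then show ?thesis
      using 3 less.IH [of m] less.IH [of "m + 1"] eps_rec [of "int m"] by (simp add: add.commute)
  qed
qed

definition diag_sum :: "int \<Rightarrow> int \<Rightarrow> int" where
  "diag_sum n k = (\<Sum>i::nat. pascal (n - 2 * int i) (k - int i))"

lemma diag_sum_rec: "diag_sum n k = pascal n k + diag_sum (n - 2) (k - 1)"
  unfolding diag_sum_def
  by (subst Sum_any_nat_shift [OF finite_support_left]) (simp add: algebra_simps)

text \<open>Position and row minus position both drop by 1 per term, so a sum that starts outside
  the triangle on either side never enters it.\<close>

lemma diag_sum_eq_0: "k < 0 \<or> n < k \<Longrightarrow> diag_sum n k = 0"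
proof -
  assume "k < 0 \<or> n < k"
  then have "pascal (n - 2 * int i) (k - int i) = 0" for i
    by (auto simp: pascal_def)
  then show ?thesis by (simp add: diag_sum_def)
qed

lemma diag_sum_eq_alt_diag:
  "int k \<le> n \<Longrightarrow> diag_sum n (int k) = alt_diag (n + 1) (int k + 1) + eps (n - 2 * int k)"
proof (induction k arbitrary: n)
  case 0
  then show ?case
    using alt_diag_1 [of "nat n"] diag_sum_rec [of n 0] by (simp add: diag_sum_eq_0 pascal_def)
next
  case (Suc k)
  define l where "l = int (Suc k)"
  show ?case
  \<comment> \<open>The edge n = l is separate because there (n - 2, l - 1) lies outside the
    triangle and the induction hypothesis does not apply.\<close>
  proof (cases "n = l")
    case True
    then have "diag_sum n l = 1" and "eps (n - 2 * l) = 0"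
      using diag_sum_rec [of n l] by (simp_all add: diag_sum_eq_0 pascal_def eps_def l_def)
    then show ?thesis
      using True alt_diag_diagonal [of "n + 1"] unfolding l_def [symmetric] by (simp add: l_def)
  next
    case False
    then have "diag_sum (n - 2) (l - 1) = alt_diag (n - 1) l + eps (n - 2 * l)"
      using Suc.IH [of "n - 2"] Suc.prems by (simp add: l_def algebra_simps)
    moreover have "alt_diag (n + 1) (l + 1) = pascal n l + alt_diag (n - 1) l"
      using Suc.prems by (intro alt_diag_two_step) (simp add: l_def)
    ultimately show ?thesis
      using diag_sum_rec [of n l] unfolding l_def [symmetric] by simp
  qed
qed

theorem mainTheorem1:
  fixes n k :: int
  assumes "0 \<le> k" and "k \<le> n"
  shows "(\<Sum>i::nat. pascal (n - 2 * int i) (k - int i))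
    = (\<Sum>j::nat. (- 1) ^ j * pascal (n + 1 - int j) (k + 1 + int j)) + eps (n - 2 * k)"
  using diag_sum_eq_alt_diag [of "nat k" n] assms by (simp add: diag_sum_def alt_diag_def)

end
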